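(* There are no complete weighted parabolic stable translating solitons in $\mathbb R^{n+1}$.
   Context: Hypersurfaces are smooth, connected, orientable, immersed, without boundary. For an oriented hypersurface $\Sigma\subset\mathbb R^{n+1}$ with unit normal $N$, $A$ is the second fundamental form and $H$ the mean curvature (the trace of the second fundamental form, with the sign $H=\mathrm{div}_\Sigma N$); $\langle\cdot,\cdot\rangle$ is the Euclidean metric. $\Sigma$ is a translating soliton if $H+\langle N,v\rangle=0$ for a fixed $v\in\mathbb S^n$. Let $\phi_T(x)=\langle x,v\rangle$; translating solitons are exactly the weighted minimal hypersurfaces of $(\mathbb R^{n+1},\langle\cdot,\cdot\rangle,\phi_T)$, i.e. critical points of the weighted area $\int_\Sigma e^{\phi_T}dv_\Sigma$ for compactly supported variations. A translating soliton is stable if the second variation of the weighted area is nonnegative for all compactly supported variations; equivalently $$\int_\Sigma|A|^2u^2e^{\phi_T}\,dv_\Sigma\le\int_\Sigma|\nabla u|^2e^{\phi_T}\,dv_\Sigma$$ for all compactly supported piecewise smooth functions $u$ on $\Sigma$. $\Sigma$, with induced metric $g$, is weighted parabolic if every function $u\ge 0$ on $\Sigma$ with $\Delta u+g(\nabla\phi_T,\nabla u)\le 0$ is constant, where $\Delta,\nabla$ are those of $g$. *)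

theory Defs
  imports "HOL-Analysis.Analysis"
begin

section \<open>Smooth maps between open sets of Euclidean spaces\<close>

(* ck_on k S f: f is k times continuously (Frechet) differentiable on the open set S. *)
primrec ck_on ::
  "nat \<Rightarrow> 'a::euclidean_space set \<Rightarrow> ('a \<Rightarrow> 'b::real_normed_vector) \<Rightarrow> bool" where
  "ck_on 0 S f \<longleftrightarrow> continuous_on S f"
| "ck_on (Suc k) S f \<longleftrightarrow>
     (\<forall>x\<in>S. f differentiable (at x)) \<and>
     (\<forall>w. ck_on k S (\<lambda>x. frechet_derivative f (at x) w))"

definition smooth_on ::
  "'a::euclidean_space set \<Rightarrow> ('a \<Rightarrow> 'b::real_normed_vector) \<Rightarrow> bool" where
  "smooth_on S f \<longleftrightarrow> (\<forall>k. ck_on k S f)"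

section \<open>Smooth manifolds and immersed hypersurfaces\<close>

(* A chart is given by its parametrization: the pair (V, x) stands for a homeomorphism x
   from the open set V of R^n onto an open set x ` V of the manifold.  The values of x
   outside V are irrelevant. *)
type_synonym ('m, 'n) chart = "(real ^ 'n) set \<times> (real ^ 'n \<Rightarrow> 'm)"

definition is_chart :: "'m topology \<Rightarrow> ('m, 'n::finite) chart \<Rightarrow> bool" where
  "is_chart M = (\<lambda>(V, x).
     open V \<and> openin M (x ` V) \<and>
     homeomorphic_map (top_of_set V) (subtopology M (x ` V)) x)"

definition smooth_atlas :: "'m topology \<Rightarrow> ('m, 'n::finite) chart set \<Rightarrow> bool" where
  "smooth_atlas M \<A> \<longleftrightarrow>
     (\<forall>c\<in>\<A>. is_chart M c) \<and>
     (\<Union>(V, x)\<in>\<A>. x ` V) = topspace M \<and>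
     (\<forall>(V, x)\<in>\<A>. \<forall>(W, y)\<in>\<A>. smooth_on {p \<in> V. x p \<in> y ` W} (inv_into W y \<circ> x))"

(* Connected (in particular nonempty) smooth manifolds without boundary, of dimension CARD('n). *)
definition connected_smooth_manifold ::
  "'m topology \<Rightarrow> ('m, 'n::finite) chart set \<Rightarrow> bool" where
  "connected_smooth_manifold M \<A> \<longleftrightarrow>
     Hausdorff_space M \<and> second_countable M \<and> connected_space M \<and> topspace M \<noteq> {} \<and>
     smooth_atlas M \<A>"

definition smooth_map ::
  "('m, 'n::finite) chart set \<Rightarrow> ('m \<Rightarrow> 'b::real_normed_vector) \<Rightarrow> bool" where
  "smooth_map \<A> f \<longleftrightarrow> (\<forall>(V, x)\<in>\<A>. smooth_on V (f \<circ> x))"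

definition immersion ::
  "('m, 'n::finite) chart set \<Rightarrow> ('m \<Rightarrow> 'a::euclidean_space) \<Rightarrow> bool" where
  "immersion \<A> F \<longleftrightarrow>
     smooth_map \<A> F \<and> (\<forall>(V, x)\<in>\<A>. \<forall>p\<in>V. inj (frechet_derivative (F \<circ> x) (at p)))"

definition unit_normal ::
  "('m, 'n::finite) chart set \<Rightarrow> ('m \<Rightarrow> 'a::euclidean_space) \<Rightarrow> ('m \<Rightarrow> 'a) \<Rightarrow> bool" where
  "unit_normal \<A> F N \<longleftrightarrow>
     smooth_map \<A> N \<and>
     (\<forall>(V, x)\<in>\<A>. \<forall>p\<in>V. norm (N (x p)) = 1 \<and>
        (\<forall>w. frechet_derivative (F \<circ> x) (at p) w \<bullet> N (x p) = 0))"

(* An immersed hypersurface of R^{n+1} is orientable iff it carries a global smooth unit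
   normal field; N is the choice of orientation. *)
definition oriented_hypersurface ::
  "'m topology \<Rightarrow> ('m, 'n::finite) chart set \<Rightarrow>
   ('m \<Rightarrow> 'a::euclidean_space) \<Rightarrow> ('m \<Rightarrow> 'a) \<Rightarrow> bool" where
  "oriented_hypersurface M \<A> F N \<longleftrightarrow>
     DIM('a) = CARD('n) + 1 \<and>
     connected_smooth_manifold M \<A> \<and> immersion \<A> F \<and> unit_normal \<A> F N"

section \<open>Local geometry of a parametrized hypersurface\<close>

(* Below, X = F o x is a local parametrization of the hypersurface, and nu = N o x and
   w = u o x are a normal field and a function read in the same chart. *)

definition pd :: "'n::finite \<Rightarrow> (real ^ 'n \<Rightarrow> 'b::real_normed_vector) \<Rightarrow> real ^ 'n \<Rightarrow> 'b" where
  "pd i f p = frechet_derivative f (at p) (axis i 1)"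

definition first_ff ::
  "(real ^ 'n::finite \<Rightarrow> 'a::euclidean_space) \<Rightarrow> real ^ 'n \<Rightarrow> real ^ 'n ^ 'n" where
  "first_ff X p = (\<chi> i j. pd i X p \<bullet> pd j X p)"

(* A(Y, Z) = <D_Y N, Z>, the sign for which the trace of A is H = div N. *)
definition second_ff ::
  "(real ^ 'n::finite \<Rightarrow> 'a::euclidean_space) \<Rightarrow> (real ^ 'n \<Rightarrow> 'a) \<Rightarrow>
   real ^ 'n \<Rightarrow> real ^ 'n ^ 'n" where
  "second_ff X \<nu> p = (\<chi> i j. pd i \<nu> p \<bullet> pd j X p)"

definition mean_curvature ::
  "(real ^ 'n::finite \<Rightarrow> 'a::euclidean_space) \<Rightarrow> (real ^ 'n \<Rightarrow> 'a) \<Rightarrow> real ^ 'n \<Rightarrow> real" where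
  "mean_curvature X \<nu> p = trace (matrix_inv (first_ff X p) ** second_ff X \<nu> p)"

(* Gamma^k_ij of the Levi-Civita connection of the induced metric. *)
definition christoffel ::
  "(real ^ 'n::finite \<Rightarrow> 'a::euclidean_space) \<Rightarrow> 'n \<Rightarrow> 'n \<Rightarrow> 'n \<Rightarrow> real ^ 'n \<Rightarrow> real" where
  "christoffel X k i j p =
     (\<Sum>l\<in>UNIV. matrix_inv (first_ff X p) $ k $ l *
        (pd i (\<lambda>q. first_ff X q $ j $ l) p + pd j (\<lambda>q. first_ff X q $ i $ l) p
         - pd l (\<lambda>q. first_ff X q $ i $ j) p)) / 2"

(* Laplace-Beltrami operator: trace of the covariant Hessian. *)
definition laplacian ::
  "(real ^ 'n::finite \<Rightarrow> 'a::euclidean_space) \<Rightarrow> (real ^ 'n \<Rightarrow> real) \<Rightarrow> real ^ 'n \<Rightarrow> real" where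
  "laplacian X w p =
     (\<Sum>i\<in>UNIV. \<Sum>j\<in>UNIV. matrix_inv (first_ff X p) $ i $ j *
        (pd i (pd j w) p - (\<Sum>k\<in>UNIV. christoffel X k i j p * pd k w p)))"

(* g(grad w1, grad w2) = sum over i, j of g^ij (d_i w1) (d_j w2). *)
definition grad_inner ::
  "(real ^ 'n::finite \<Rightarrow> 'a::euclidean_space) \<Rightarrow> (real ^ 'n \<Rightarrow> real) \<Rightarrow> (real ^ 'n \<Rightarrow> real) \<Rightarrow>
   real ^ 'n \<Rightarrow> real" where
  "grad_inner X w\<^sub>1 w\<^sub>2 p =
     (\<Sum>i\<in>UNIV. \<Sum>j\<in>UNIV. matrix_inv (first_ff X p) $ i $ j * pd i w\<^sub>1 p * pd j w\<^sub>2 p)"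

section \<open>Translating solitons\<close>

definition translating_soliton ::
  "'m topology \<Rightarrow> ('m, 'n::finite) chart set \<Rightarrow>
   ('m \<Rightarrow> 'a::euclidean_space) \<Rightarrow> ('m \<Rightarrow> 'a) \<Rightarrow> 'a \<Rightarrow> bool" where
  "translating_soliton M \<A> F N v \<longleftrightarrow>
     oriented_hypersurface M \<A> F N \<and>
     (\<forall>(V, x)\<in>\<A>. \<forall>p\<in>V. mean_curvature (F \<circ> x) (N \<circ> x) p + N (x p) \<bullet> v = 0)"

section \<open>Completeness of the induced metric\<close>

(* As F is an immersion, a continuous curve c in M is piecewise C^1 iff F o c is, and its
   length for the induced metric is the length of F o c.  The derivative may be unbounded
   near a break point, whence the [0, infinity]-valued integral. *)
definition curve_length :: "(real \<Rightarrow> 'a::euclidean_space) \<Rightarrow> ennreal" where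
  "curve_length c =
     (\<integral>\<^sup>+t. ennreal (norm (vector_derivative c (at t))) * indicator {0..1} t \<partial>lborel)"

definition intrinsic_dist ::
  "'m topology \<Rightarrow> ('m \<Rightarrow> 'a::euclidean_space) \<Rightarrow> 'm \<Rightarrow> 'm \<Rightarrow> real" where
  "intrinsic_dist M F p q =
     enn2real (INF c \<in> {c. pathin M c \<and> c 0 = p \<and> c 1 = q \<and>
                           (F \<circ> c) piecewise_C1_differentiable_on {0..1}}.
                 curve_length (F \<circ> c))"

definition complete_hypersurface ::
  "'m topology \<Rightarrow> ('m \<Rightarrow> 'a::euclidean_space) \<Rightarrow> bool" where
  "complete_hypersurface M F \<longleftrightarrow> Metric_space.mcomplete (topspace M) (intrinsic_dist M F)"

section \<open>Weighted parabolicity\<close>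

definition weighted_parabolic ::
  "'m topology \<Rightarrow> ('m, 'n::finite) chart set \<Rightarrow> ('m \<Rightarrow> 'a::euclidean_space) \<Rightarrow>
   ('a \<Rightarrow> real) \<Rightarrow> bool" where
  "weighted_parabolic M \<A> F \<phi> \<longleftrightarrow>
     (\<forall>u :: 'm \<Rightarrow> real.
        smooth_map \<A> u \<and> (\<forall>q \<in> topspace M. u q \<ge> 0) \<and>
        (\<forall>(V, x)\<in>\<A>. \<forall>p\<in>V.
           laplacian (F \<circ> x) (u \<circ> x) p
           + grad_inner (F \<circ> x) (\<phi> \<circ> F \<circ> x) (u \<circ> x) p \<le> 0)
        \<longrightarrow> (\<exists>c. \<forall>q \<in> topspace M. u q = c))"

section \<open>Stability\<close>

(* Integral of a nonnegative Borel function f for the Riemannian measure dv of the metric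
   induced by F: in a chart, dv = sqrt (det g) dp.  The supremum runs over the finite families
   of pairwise disjoint Borel pieces x ` B, each inside one chart (V, x); as countably many
   charts cover M, these pieces exhaust M. *)
definition surface_integral ::
  "('m, 'n::finite) chart set \<Rightarrow> ('m \<Rightarrow> 'a::euclidean_space) \<Rightarrow> ('m \<Rightarrow> ennreal) \<Rightarrow> ennreal" where
  "surface_integral \<A> F f =
     (SUP P \<in> {P. finite P \<and>
                  (\<forall>(V, x, B)\<in>P. (V, x) \<in> \<A> \<and> B \<subseteq> V \<and> B \<in> sets borel) \<and>
                  disjoint_family_on (\<lambda>(V, x, B). x ` B) P}.
        \<Sum>(V, x, B)\<in>P.
          \<integral>\<^sup>+p. f (x p) * ennreal (sqrt (det (first_ff (F \<circ> x) p))) * indicator B p \<partial>lborel)"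

definition weighted_area ::
  "('m, 'n::finite) chart set \<Rightarrow> ('a::euclidean_space \<Rightarrow> real) \<Rightarrow> 'm set \<Rightarrow> ('m \<Rightarrow> 'a) \<Rightarrow> real" where
  "weighted_area \<A> \<phi> K F =
     enn2real (surface_integral \<A> F (\<lambda>q. ennreal (exp (\<phi> (F q))) * indicator K q))"

(* Variations of F through immersions, fixing F outside the compact set K. *)
definition compact_variation ::
  "'m topology \<Rightarrow> ('m, 'n::finite) chart set \<Rightarrow> ('m \<Rightarrow> 'a::euclidean_space) \<Rightarrow>
   'm set \<Rightarrow> real \<Rightarrow> (real \<Rightarrow> 'm \<Rightarrow> 'a) \<Rightarrow> bool" where
  "compact_variation M \<A> F K \<epsilon> \<Phi> \<longleftrightarrow>
     compactin M K \<and> \<epsilon> > 0 \<and>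
     (\<forall>(V, x)\<in>\<A>. smooth_on ({-\<epsilon><..<\<epsilon>} \<times> V) (\<lambda>(t, p). \<Phi> t (x p))) \<and>
     (\<forall>t\<in>{-\<epsilon><..<\<epsilon>}. immersion \<A> (\<Phi> t)) \<and>
     (\<forall>q\<in>topspace M. \<Phi> 0 q = F q) \<and>
     (\<forall>t\<in>{-\<epsilon><..<\<epsilon>}. \<forall>q\<in>topspace M - K. \<Phi> t q = F q)"

(* Outside K the variation leaves the weighted area unchanged, so it suffices to
   differentiate the (finite) weighted area of K. *)
definition stable_hypersurface ::
  "'m topology \<Rightarrow> ('m, 'n::finite) chart set \<Rightarrow> ('m \<Rightarrow> 'a::euclidean_space) \<Rightarrow>
   ('a \<Rightarrow> real) \<Rightarrow> bool" where
  "stable_hypersurface M \<A> F \<phi> \<longleftrightarrow>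
     (\<forall>K \<epsilon> \<Phi>. compact_variation M \<A> F K \<epsilon> \<Phi> \<longrightarrow>
        (deriv ^^ 2) (\<lambda>t. weighted_area \<A> \<phi> K (\<Phi> t)) 0 \<ge> 0)"

end

theory Submission
  imports Defs
begin

text \<open>
  With \<open>w = \<langle>F, v\<rangle>\<close> the height function, \<open>\<Delta> F = - H N\<close> and \<open>H = - \<langle>N, v\<rangle>\<close> give
  \<open>\<Delta> w = \<langle>N, v\<rangle>\<^sup>2\<close>.  The function \<open>u = exp (- w) > 0\<close> satisfies
  \<open>\<Delta> u + g(\<nabla>w, \<nabla>u) = - u \<Delta> w = - u \<langle>N, v\<rangle>\<^sup>2 \<le> 0\<close>, so on a weighted parabolic soliton
  \<open>u\<close>, hence \<open>w\<close>, would be constant.  Then \<open>v\<close> is normal to the hypersurface,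
  so \<open>\<langle>N, v\<rangle>\<^sup>2 = 1\<close>, contradicting \<open>\<Delta> w = 0\<close>.
\<close>

section \<open>Calculus of \<open>ck_on\<close>\<close>

lemma frechet_derivative_eqI:
  "(f has_derivative f') (at x) \<Longrightarrow> frechet_derivative f (at x) = f'"
  by (rule frechet_derivative_at[symmetric])

text \<open>\<open>frechet_derivative\<close> is a choice operator applied to the predicate of being
  a derivative. Near x the two functions satisfy the same predicate, so the chosen values coincide,
  even at points where no derivative exists.\<close>

lemma frechet_derivative_cong_open:
  assumes "open S" "x \<in> S" "\<And>y. y \<in> S \<Longrightarrow> f y = g y"
  shows "frechet_derivative f (at x) = frechet_derivative g (at x)"
proof -
  have "(f has_derivative D) (at x) \<longleftrightarrow> (g has_derivative D) (at x)" for D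
    using has_derivative_transform_within_open[OF _ assms(1,2), where f = f and f' = D and g = g]
      has_derivative_transform_within_open[OF _ assms(1,2), where f = g and f' = D and g = f] assms(3) by auto
  then show ?thesis
    unfolding frechet_derivative_def by simp
qed

lemma differentiable_cong_open:
  assumes "open S" "x \<in> S" "\<And>y. y \<in> S \<Longrightarrow> f y = g y" "f differentiable (at x)"
  shows "g differentiable (at x)"
  using has_derivative_transform_within_open[OF _ assms(1,2), where f = f and g = g] assms(3,4)
  unfolding differentiable_def by blast

text \<open>The calculus rules below know a derivative only through a formula valid on S. This lemma
  lets that formula replace \<open>frechet_derivative\<close> inside the recursion of
  \<open>ck_on\<close>; openness of S makes values on S determine derivatives on S.\<close>

lemma ck_on_cong:
  assumes "open S" "\<And>x. x \<in> S \<Longrightarrow> f x = g x" "ck_on k S f"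
  shows "ck_on k S g"
  using assms(2,3)
proof (induction k arbitrary: f g)
  case 0
  then show ?case by (simp cong: continuous_on_cong)
next
  case (Suc k)
  have "g differentiable (at x)" if "x \<in> S" for x
    using differentiable_cong_open[OF assms(1) that Suc.prems(1)] Suc.prems(2) that by auto
  moreover have "ck_on k S (\<lambda>x. frechet_derivative g (at x) w)" for w
  proof (rule Suc.IH)
    show "ck_on k S (\<lambda>x. frechet_derivative f (at x) w)"
      using Suc.prems(2) by simp
    show "frechet_derivative f (at x) w = frechet_derivative g (at x) w" if "x \<in> S" for x
      using frechet_derivative_cong_open[OF assms(1) that Suc.prems(1)] by simp
  qed
  ultimately show ?case by simp
qed

text \<open>Differentiability gives continuity in the base case. The product and exponential rules
  use this because their derivatives still contain the undifferentiated functions, which must be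
  available at order k as well.\<close>

lemma ck_on_SucD: "ck_on (Suc k) S f \<Longrightarrow> ck_on k S f"
proof (induction k arbitrary: f)
  case 0
  then show ?case
    by (auto intro!: continuous_at_imp_continuous_on differentiable_imp_continuous_within)
next
  case (Suc k)
  have "ck_on k S (\<lambda>x. frechet_derivative f (at x) w)" for w
    using Suc.prems by (intro Suc.IH) simp
  then show ?case using Suc.prems by simp
qed

lemma ck_on_bounded_linear:
  assumes "open S" "bounded_linear L" "ck_on k S f"
  shows "ck_on k S (\<lambda>x. L (f x))"
  using assms(3)
proof (induction k arbitrary: f)
  case 0
  then show ?case
    by (simp add: bounded_linear.continuous_on[OF assms(2)])
next
  case (Suc k)
  have D: "((\<lambda>y. L (f y)) has_derivative (\<lambda>w. L (frechet_derivative f (at x) w))) (at x)"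
    if "x \<in> S" for x
    using Suc.prems that
    by (intro bounded_linear.has_derivative[OF assms(2)]) (simp add: frechet_derivative_works)
  have "ck_on k S (\<lambda>x. L (frechet_derivative f (at x) w))" for w
    using Suc by simp
  then have "ck_on k S (\<lambda>x. frechet_derivative (\<lambda>y. L (f y)) (at x) w)" for w
    by (rule ck_on_cong[OF assms(1), rotated]) (simp add: frechet_derivative_eqI[OF D])
  then show ?case
    using D by (auto simp: differentiable_def)
qed

lemma ck_on_add:
  assumes "open S" "ck_on k S f" "ck_on k S g"
  shows "ck_on k S (\<lambda>x. f x + g x)"
  using assms(2,3)
proof (induction k arbitrary: f g)
  case 0
  then show ?case by (simp add: continuous_on_add)
next
  case (Suc k)
  have D: "((\<lambda>y. f y + g y) has_derivative
      (\<lambda>w. frechet_derivative f (at x) w + frechet_derivative g (at x) w)) (at x)"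
    if "x \<in> S" for x
    using Suc.prems that by (intro has_derivative_add) (simp_all add: frechet_derivative_works)
  have "ck_on k S (\<lambda>x. frechet_derivative f (at x) w + frechet_derivative g (at x) w)" for w
    using Suc by simp
  then have "ck_on k S (\<lambda>x. frechet_derivative (\<lambda>y. f y + g y) (at x) w)" for w
    by (rule ck_on_cong[OF assms(1), rotated]) (simp add: frechet_derivative_eqI[OF D])
  then show ?case
    using D by (auto simp: differentiable_def)
qed

lemma ck_on_mult:
  fixes f g :: "'a::euclidean_space \<Rightarrow> real"
  assumes "open S" "ck_on k S f" "ck_on k S g"
  shows "ck_on k S (\<lambda>x. f x * g x)"
  using assms(2,3)
proof (induction k arbitrary: f g)
  case 0
  then show ?case by (simp add: continuous_on_mult)
next
  case (Suc k)
  have D: "((\<lambda>y. f y * g y) has_derivative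
      (\<lambda>w. f x * frechet_derivative g (at x) w + frechet_derivative f (at x) w * g x)) (at x)"
    if "x \<in> S" for x
    using Suc.prems that by (intro has_derivative_mult) (simp_all add: frechet_derivative_works)
  have "ck_on k S (\<lambda>x. f x * frechet_derivative g (at x) w + frechet_derivative f (at x) w * g x)"
    for w
    using Suc.prems ck_on_SucD[OF Suc.prems(1)] ck_on_SucD[OF Suc.prems(2)]
    by (intro ck_on_add[OF assms(1)] Suc.IH) simp_all
  then have "ck_on k S (\<lambda>x. frechet_derivative (\<lambda>y. f y * g y) (at x) w)" for w
    by (rule ck_on_cong[OF assms(1), rotated]) (simp add: frechet_derivative_eqI[OF D])
  then show ?case
    using D by (auto simp: differentiable_def)
qed

text \<open>The derivative of exp f is exp f times the derivative of f. The same exponential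
  reappears, so the induction runs with f fixed, and \<open>ck_on_mult\<close> handles the other
  factor.\<close>

lemma ck_on_exp:
  fixes f :: "'a::euclidean_space \<Rightarrow> real"
  assumes "open S" "ck_on k S f"
  shows "ck_on k S (\<lambda>x. exp (f x))"
  using assms(2)
proof (induction k)
  case 0
  then show ?case by (simp add: continuous_on_exp)
next
  case (Suc k)
  have D: "((\<lambda>y. exp (f y)) has_derivative (\<lambda>w. exp (f x) * frechet_derivative f (at x) w)) (at x)"
    if "x \<in> S" for x
  proof -
    have "(f has_derivative frechet_derivative f (at x)) (at x)"
      using Suc.prems that by (simp add: frechet_derivative_works)
    from has_derivative_exp[OF this] show ?thesis
      by (simp add: mult.commute)
  qed
  have "ck_on k S (\<lambda>x. exp (f x) * frechet_derivative f (at x) w)" for w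
    using Suc.prems Suc.IH[OF ck_on_SucD[OF Suc.prems]]
    by (intro ck_on_mult[OF assms(1)]) simp_all
  then have "ck_on k S (\<lambda>x. frechet_derivative (\<lambda>y. exp (f y)) (at x) w)" for w
    by (rule ck_on_cong[OF assms(1), rotated]) (simp add: frechet_derivative_eqI[OF D])
  then show ?case
    using D by (auto simp: differentiable_def)
qed

text \<open>Supplies the smoothness, read in a chart, of the test function to which weighted
  parabolicity is applied.\<close>

lemma smooth_on_exp_neg_inner:
  assumes "open S" "smooth_on S X"
  shows "smooth_on S (\<lambda>p. exp (- (X p \<bullet> v)))"
  using assms unfolding smooth_on_def
  by (intro allI ck_on_exp ck_on_bounded_linear[where L = "\<lambda>y. - (y \<bullet> v)"])
    (auto intro: bounded_linear_minus bounded_linear_inner_left)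

section \<open>Symmetry of second derivatives\<close>

text \<open>The mean value theorem is applied twice, first along a and then along b. The bound on h
  keeps the whole parallelogram spanned by h a and h b at p inside the ball.\<close>

lemma second_difference_MVT:
  fixes f :: "'a::euclidean_space \<Rightarrow> real"
  assumes ball: "ball p r \<subseteq> V"
    and f: "\<And>q. q \<in> V \<Longrightarrow> f differentiable (at q)"
    and fa: "\<And>q. q \<in> V \<Longrightarrow> (\<lambda>y. frechet_derivative f (at y) a) differentiable (at q)"
    and h: "0 < h" "h * (norm a + norm b) < r"
  obtains q where "q \<in> ball p r"
    "f (p + h *\<^sub>R a + h *\<^sub>R b) - f (p + h *\<^sub>R a) - f (p + h *\<^sub>R b) + f p
      = h * h * frechet_derivative (\<lambda>y. frechet_derivative f (at y) a) (at q) b"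
proof -
  have shift: "dist p (p + w) = norm w" for w
    unfolding dist_norm by (metis add_diff_cancel_left' norm_minus_commute)
  have near: "dist p (p + s *\<^sub>R a + t *\<^sub>R b) \<le> h * (norm a + norm b)"
    if "0 \<le> s" "s \<le> h" "0 \<le> t" "t \<le> h" for s t
  proof -
    have "dist p (p + s *\<^sub>R a + t *\<^sub>R b) = norm (s *\<^sub>R a + t *\<^sub>R b)"
      using shift[of "s *\<^sub>R a + t *\<^sub>R b"] by (simp only: add.assoc)
    also have "\<dots> \<le> s * norm a + t * norm b"
      using norm_triangle_ineq[of "s *\<^sub>R a" "t *\<^sub>R b"] that by simp
    also have "\<dots> \<le> h * norm a + h * norm b"
      using that by (intro add_mono mult_right_mono) auto
    finally show ?thesis by (simp add: algebra_simps)
  qed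
  have inV: "p + s *\<^sub>R a + t *\<^sub>R b \<in> V" if "0 \<le> s" "s \<le> h" "0 \<le> t" "t \<le> h" for s t
    using near[OF that] h ball by auto
  have line: "((\<lambda>t. G (c + t *\<^sub>R d)) has_real_derivative frechet_derivative G (at (c + t *\<^sub>R d)) d) (at t)"
    if "G differentiable (at (c + t *\<^sub>R d))" for G :: "'a \<Rightarrow> real" and c d t
  proof -
    have G: "(G has_derivative frechet_derivative G (at (c + t *\<^sub>R d))) (at (c + t *\<^sub>R d))"
      using that by (simp add: frechet_derivative_works)
    have "((\<lambda>t. c + t *\<^sub>R d) has_derivative (\<lambda>s. s *\<^sub>R d)) (at t)"
      by (auto intro!: derivative_eq_intros)
    from has_derivative_compose[OF this G]
    have "((\<lambda>t. G (c + t *\<^sub>R d)) has_derivative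
        (\<lambda>s. frechet_derivative G (at (c + t *\<^sub>R d)) (s *\<^sub>R d))) (at t)" .
    then show ?thesis
      using linear_scale[OF linear_frechet_derivative[OF that]]
      by (simp add: has_field_derivative_def mult.commute[of _ "frechet_derivative G _ d"]
          mult_commute_abs)
  qed
  have comm: "p + h *\<^sub>R b + s *\<^sub>R a = p + s *\<^sub>R a + h *\<^sub>R b" for s
    by (simp only: ac_simps)
  \<comment> \<open>The second difference is the increment of \<open>\<psi>\<close> from 0 to h: a
    difference in direction b, regarded as a function of the displacement along a.\<close>
  define \<psi> where "\<psi> s = f (p + h *\<^sub>R b + s *\<^sub>R a) - f (p + s *\<^sub>R a)" for s
  have "(\<psi> has_real_derivative (frechet_derivative f (at (p + h *\<^sub>R b + s *\<^sub>R a)) a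
      - frechet_derivative f (at (p + s *\<^sub>R a)) a)) (at s)" if "0 \<le> s" "s \<le> h" for s
    unfolding \<psi>_def
    using inV[of s h] inV[of s 0] that h
    by (intro DERIV_diff line f) (simp_all add: comm)
  from MVT2[OF h(1) this] obtain \<theta> where \<theta>: "0 < \<theta>" "\<theta> < h"
    and 1: "\<psi> h - \<psi> 0 = (h - 0) * (frechet_derivative f (at (p + h *\<^sub>R b + \<theta> *\<^sub>R a)) a
      - frechet_derivative f (at (p + \<theta> *\<^sub>R a)) a)"
    by blast
  \<comment> \<open>The first mean value step leaves a difference of a-derivatives at two points
    that differ by h b; the second one is applied on the segment between them.\<close>
  let ?g = "\<lambda>y. frechet_derivative f (at y) a"
  have "((\<lambda>t. ?g (p + \<theta> *\<^sub>R a + t *\<^sub>R b)) has_real_derivative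
      frechet_derivative ?g (at (p + \<theta> *\<^sub>R a + t *\<^sub>R b)) b) (at t)" if "0 \<le> t" "t \<le> h" for t
    using inV[of \<theta> t] that \<theta> by (intro line fa) simp_all
  from MVT2[OF h(1) this] obtain \<eta> where \<eta>: "0 < \<eta>" "\<eta> < h"
    and 2: "?g (p + \<theta> *\<^sub>R a + h *\<^sub>R b) - ?g (p + \<theta> *\<^sub>R a + 0 *\<^sub>R b)
      = (h - 0) * frechet_derivative ?g (at (p + \<theta> *\<^sub>R a + \<eta> *\<^sub>R b)) b"
    by blast
  show thesis
  proof
    show "p + \<theta> *\<^sub>R a + \<eta> *\<^sub>R b \<in> ball p r"
      using near[of \<theta> \<eta>] \<theta> \<eta> h by simp
    show "f (p + h *\<^sub>R a + h *\<^sub>R b) - f (p + h *\<^sub>R a) - f (p + h *\<^sub>R b) + f p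
      = h * h * frechet_derivative ?g (at (p + \<theta> *\<^sub>R a + \<eta> *\<^sub>R b)) b"
      using 1[unfolded \<psi>_def comm] 2 by simp
  qed
qed

text \<open>The second difference is symmetric in a and b, so \<open>second_difference_MVT\<close>,
  used in both orders, gives points q and q' near p at which the two mixed derivatives agree.
  Continuity of both at p then bounds their distance at p by less than 2e, which is that distance
  itself.\<close>

lemma second_derivative_symmetric_real:
  fixes f :: "'a::euclidean_space \<Rightarrow> real"
  assumes "open V" "p \<in> V" and C2: "ck_on 2 V f"
  shows "frechet_derivative (\<lambda>y. frechet_derivative f (at y) a) (at p) b
       = frechet_derivative (\<lambda>y. frechet_derivative f (at y) b) (at p) a"
    (is "?A p = ?B p")
proof (rule ccontr)
  assume "?A p \<noteq> ?B p"
  define e where "e = dist (?A p) (?B p) / 2"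
  have e: "e > 0" using \<open>?A p \<noteq> ?B p\<close> by (simp add: e_def)
  have f: "\<And>q. q \<in> V \<Longrightarrow> f differentiable (at q)"
    and fd: "\<And>q c. q \<in> V \<Longrightarrow> (\<lambda>y. frechet_derivative f (at y) c) differentiable (at q)"
    and cont: "continuous_on V ?A" "continuous_on V ?B"
    using C2 by (simp_all add: numeral_2_eq_2)
  obtain r0 where r0: "r0 > 0" "ball p r0 \<subseteq> V"
    using assms openE by blast
  obtain r1 where r1: "r1 > 0" "\<And>q. q \<in> V \<Longrightarrow> dist q p < r1 \<Longrightarrow> dist (?A q) (?A p) < e"
    using cont(1) assms(2) e unfolding continuous_on_iff by blast
  obtain r2 where r2: "r2 > 0" "\<And>q. q \<in> V \<Longrightarrow> dist q p < r2 \<Longrightarrow> dist (?B q) (?B p) < e"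
    using cont(2) assms(2) e unfolding continuous_on_iff by blast
  define r where "r = min r0 (min r1 r2)"
  have r: "r > 0" "ball p r \<subseteq> V"
    using r0 r1 r2 unfolding r_def by auto
  \<comment> \<open>The factor 2 gives h (|a| + |b|) < r / 2; the summand 1 keeps the denominator
    positive when a = b = 0.\<close>
  define h where "h = r / (2 * (norm a + norm b + 1))"
  have pos: "norm a + norm b + 1 > 0"
    by (simp add: add_nonneg_pos)
  have h: "h > 0" using r pos by (simp add: h_def)
  have "h * (norm a + norm b) < h * (norm a + norm b + 1)" using h by simp
  also have "\<dots> = r / 2" using pos by (simp add: h_def field_simps)
  finally have hr: "h * (norm a + norm b) < r" using r by simp
  obtain q where q: "q \<in> ball p r" and A: "f (p + h *\<^sub>R a + h *\<^sub>R b) - f (p + h *\<^sub>R a)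
      - f (p + h *\<^sub>R b) + f p = h * h * ?A q"
    by (rule second_difference_MVT[OF r(2) f fd h hr])
  have hr': "h * (norm b + norm a) < r" using hr by (simp add: add.commute)
  obtain q' where q': "q' \<in> ball p r" and B: "f (p + h *\<^sub>R b + h *\<^sub>R a) - f (p + h *\<^sub>R b)
      - f (p + h *\<^sub>R a) + f p = h * h * ?B q'"
    by (rule second_difference_MVT[OF r(2) f fd h hr'])
  have "f (p + h *\<^sub>R a + h *\<^sub>R b) = f (p + h *\<^sub>R b + h *\<^sub>R a)"
    by (simp add: ac_simps)
  with A B have "h * h * ?A q = h * h * ?B q'" by linarith
  then have "?A q = ?B q'" using h by simp
  moreover have "dist (?A q) (?A p) < e"
    using q r(2) by (intro r1) (auto simp: r_def dist_commute)
  moreover have "dist (?B q') (?B p) < e"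
    using q' r(2) by (intro r2) (auto simp: r_def dist_commute)
  ultimately show False
    unfolding e_def dist_real_def by (auto simp: abs_if split: if_splits)
qed

lemma frechet_derivative_inner_left:
  assumes "f differentiable (at p)"
  shows "frechet_derivative (\<lambda>q. f q \<bullet> c) (at p) w = frechet_derivative f (at p) w \<bullet> c"
proof -
  have "((\<lambda>q. f q \<bullet> c) has_derivative (\<lambda>w. frechet_derivative f (at p) w \<bullet> c)) (at p)"
    using assms by (intro has_derivative_inner_left) (simp add: frechet_derivative_works)
  then show ?thesis
    by (simp add: frechet_derivative_eqI)
qed

text \<open>Taking the inner product with an arbitrary vector c commutes with differentiation and
  reduces the claim to the real-valued case.\<close>

lemma second_derivative_symmetric:
  fixes f :: "'a::euclidean_space \<Rightarrow> 'b::euclidean_space"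
  assumes V: "open V" "p \<in> V" and C2: "ck_on 2 V f"
  shows "frechet_derivative (\<lambda>y. frechet_derivative f (at y) a) (at p) b
       = frechet_derivative (\<lambda>y. frechet_derivative f (at y) b) (at p) a"
proof (rule vector_eq_rdot[THEN iffD1], rule allI)
  fix c
  have f: "\<And>q. q \<in> V \<Longrightarrow> f differentiable (at q)"
    and fd: "\<And>q c. q \<in> V \<Longrightarrow> (\<lambda>y. frechet_derivative f (at y) c) differentiable (at q)"
    using C2 by (simp_all add: numeral_2_eq_2)
  have *: "frechet_derivative (\<lambda>y. frechet_derivative (\<lambda>q. f q \<bullet> c) (at y) a) (at p) b
      = frechet_derivative (\<lambda>y. frechet_derivative f (at y) a) (at p) b \<bullet> c" for a b
    using frechet_derivative_cong_open[OF V, of "\<lambda>y. frechet_derivative (\<lambda>q. f q \<bullet> c) (at y) a"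
        "\<lambda>y. frechet_derivative f (at y) a \<bullet> c"]
    by (simp add: frechet_derivative_inner_left f fd V)
  have "ck_on 2 V (\<lambda>q. f q \<bullet> c)"
    using ck_on_bounded_linear[OF V(1) bounded_linear_inner_left C2] .
  from second_derivative_symmetric_real[OF V this, of a b]
  show "frechet_derivative (\<lambda>y. frechet_derivative f (at y) a) (at p) b \<bullet> c
      = frechet_derivative (\<lambda>y. frechet_derivative f (at y) b) (at p) a \<bullet> c"
    by (simp add: *)
qed

section \<open>Normal vectors of a hyperplane\<close>

text \<open>The range of L has codimension one and does not contain n, so together with n it spans
  the space. The difference of y and its component along n is orthogonal to this spanning set, hence
  to itself.\<close>

lemma orthogonal_to_hyperplane:
  fixes L :: "real ^ 'n::finite \<Rightarrow> 'a::euclidean_space"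
  assumes L: "linear L" "inj L" and dim: "DIM('a) = CARD('n) + 1"
    and n: "norm n = 1" "\<And>w. L w \<bullet> n = 0" and y: "\<And>w. L w \<bullet> y = 0"
  shows "y = (y \<bullet> n) *\<^sub>R n"
proof -
  have nn: "n \<bullet> n = 1" using n(1) by (simp add: norm_eq_1)
  have sub: "span (range L) = range L"
    using L(1) by (simp add: linear_subspace_image)
  have "n \<notin> span (range L)"
    using n(2) nn unfolding sub by (metis imageE zero_neq_one)
  moreover have "dim (range L) = CARD('n)"
    using dim_image_eq[OF L(1), of UNIV] L(2) by simp
  ultimately have "dim (insert n (range L)) = DIM('a)"
    using dim by (simp add: dim_insert)
  then have full: "span (insert n (range L)) = UNIV"
    by (simp add: dim_eq_full)
  let ?z = "y - (y \<bullet> n) *\<^sub>R n"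
  have "orthogonal ?z x" if "x \<in> insert n (range L)" for x
    using that n(2) y nn
    by (auto simp: orthogonal_def inner_diff_left inner_commute[of _ "L _"])
  then have "orthogonal ?z ?z"
    using orthogonal_to_span[of ?z "insert n (range L)" ?z] full by auto
  then show ?thesis
    by (simp add: orthogonal_def)
qed

section \<open>The height function of a hypersurface patch\<close>

text \<open>An oriented hypersurface read in one chart: \<open>X\<close> stands for F o x and
  \<open>\<nu>\<close> for N o x, so that all geometry becomes calculus on the open set V.\<close>

locale hypersurface_patch =
  fixes V :: "(real ^ 'n::finite) set" and X \<nu> :: "real ^ 'n \<Rightarrow> 'a::euclidean_space"
  assumes dim: "DIM('a) = CARD('n) + 1"
    and open_V: "open V"
    and smooth_X: "smooth_on V X"
    and smooth_\<nu>: "smooth_on V \<nu>"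
    and inj_dX: "\<And>p. p \<in> V \<Longrightarrow> inj (frechet_derivative X (at p))"
    and norm_\<nu>: "\<And>p. p \<in> V \<Longrightarrow> norm (\<nu> p) = 1"
    and normal_\<nu>: "\<And>p w. p \<in> V \<Longrightarrow> frechet_derivative X (at p) w \<bullet> \<nu> p = 0"
begin

lemma C2_X: "ck_on 2 V X"
  using smooth_X by (simp add: smooth_on_def)

lemma diff_X: "p \<in> V \<Longrightarrow> X differentiable (at p)"
  and diff_pd_X: "p \<in> V \<Longrightarrow> pd i X differentiable (at p)"
  using C2_X by (simp_all add: numeral_2_eq_2 pd_def[abs_def])

lemma diff_\<nu>: "p \<in> V \<Longrightarrow> \<nu> differentiable (at p)"
  using smooth_\<nu> unfolding smooth_on_def by (metis ck_on.simps(2))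

lemma pd_pd_commute: "p \<in> V \<Longrightarrow> pd i (pd j X) p = pd j (pd i X) p"
  using second_derivative_symmetric[OF open_V _ C2_X] by (simp add: pd_def[abs_def])

lemma pd_inner:
  assumes "f differentiable (at p)" "g differentiable (at p)"
  shows "pd i (\<lambda>q. f q \<bullet> g q) p = pd i f p \<bullet> g p + f p \<bullet> pd i g p"
proof -
  have "((\<lambda>q. f q \<bullet> g q) has_derivative (\<lambda>w. f p \<bullet> frechet_derivative g (at p) w
      + frechet_derivative f (at p) w \<bullet> g p)) (at p)"
    using assms by (intro has_derivative_inner) (simp_all add: frechet_derivative_works)
  then show ?thesis
    by (simp add: pd_def frechet_derivative_eqI)
qed

lemma pd_cong:
  assumes "p \<in> V" "\<And>q. q \<in> V \<Longrightarrow> f q = g q"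
  shows "pd i f p = pd i g p"
  using frechet_derivative_cong_open[OF open_V assms] by (simp add: pd_def)

lemma pd_inner_const:
  "f differentiable (at p) \<Longrightarrow> pd i (\<lambda>q. f q \<bullet> c) p = pd i f p \<bullet> c"
  by (simp add: pd_def frechet_derivative_inner_left)

section \<open>Tangent space and first fundamental form\<close>

lemma dX_eq_sum:
  assumes "p \<in> V"
  shows "frechet_derivative X (at p) c = (\<Sum>i\<in>UNIV. c $ i *\<^sub>R pd i X p)"
proof -
  have lin: "linear (frechet_derivative X (at p))"
    using diff_X[OF assms] by (rule linear_frechet_derivative)
  have "c = (\<Sum>i\<in>UNIV. c $ i *\<^sub>R axis i 1)"
    by (metis (no_types, lifting) basis_expansion scalar_mult_eq_scaleR sum.cong)
  then have "frechet_derivative X (at p) c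
      = frechet_derivative X (at p) (\<Sum>i\<in>UNIV. c $ i *\<^sub>R axis i 1)"
    by simp
  also have "\<dots> = (\<Sum>i\<in>UNIV. c $ i *\<^sub>R pd i X p)"
    by (simp add: linear_sum[OF lin] linear_scale[OF lin] pd_def)
  finally show ?thesis .
qed

text \<open>\<open>first_ff\<close> is the Gram matrix of the coordinate tangent vectors. If it
  annihilates c, then dX(c) is orthogonal to all of them, hence to itself, and injectivity of dX
  gives c = 0.\<close>

lemma first_ff_inv:
  assumes "p \<in> V"
  shows "first_ff X p ** matrix_inv (first_ff X p) = mat 1"
proof -
  have "c = 0" if c: "first_ff X p *v c = 0" for c
  proof -
    let ?D = "frechet_derivative X (at p)"
    have "?D c \<bullet> pd j X p = (first_ff X p *v c) $ j" for j
      by (simp add: dX_eq_sum[OF assms] inner_sum_left matrix_vector_mult_def first_ff_def)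
        (simp add: inner_commute mult.commute)
    then have "?D c \<bullet> pd j X p = 0" for j
      using c by simp
    then have "?D c \<bullet> ?D c = 0"
      by (subst (2) dX_eq_sum[OF assms]) (simp add: inner_sum_right)
    then have "?D c = ?D 0"
      using linear_0[OF linear_frechet_derivative[OF diff_X[OF assms]]] by simp
    then show "c = 0"
      using inj_dX[OF assms] by (metis injD)
  qed
  then obtain B where "B ** first_ff X p = mat 1"
    using matrix_left_invertible_ker by metis
  \<comment> \<open>\<open>matrix_inv\<close> is a choice among two-sided inverses, so the existence
    of one of these has to be shown.\<close>
  then have "\<exists>B. first_ff X p ** B = mat 1 \<and> B ** first_ff X p = mat 1"
    using matrix_left_right_inverse by blast
  from someI_ex[OF this] show ?thesis
    unfolding matrix_inv_def by blast
qed

text \<open>Serves twice: for the remainder in the Gauss formula, and for v itself once the height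
  is constant.\<close>

lemma orthogonal_tangent_imp_normal:
  assumes "p \<in> V" "\<And>i. pd i X p \<bullet> y = 0"
  shows "y = (y \<bullet> \<nu> p) *\<^sub>R \<nu> p"
proof (rule orthogonal_to_hyperplane[OF _ inj_dX[OF assms(1)] dim norm_\<nu>[OF assms(1)] normal_\<nu>[OF assms(1)]])
  show "linear (frechet_derivative X (at p))"
    using diff_X[OF assms(1)] by (rule linear_frechet_derivative)
  show "frechet_derivative X (at p) w \<bullet> y = 0" for w
    using assms(2) by (simp add: dX_eq_sum[OF assms(1)] inner_sum_left)
qed

section \<open>Gauss formula and second fundamental form\<close>

lemma christoffel_eq:
  assumes "p \<in> V"
  shows "christoffel X k i j p =
    (\<Sum>l\<in>UNIV. matrix_inv (first_ff X p) $ k $ l * (pd i (pd j X) p \<bullet> pd l X p))"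
proof -
  have g: "pd i (\<lambda>q. first_ff X q $ j $ l) p = pd i (pd j X) p \<bullet> pd l X p + pd j X p \<bullet> pd i (pd l X) p"
    for i j l
    by (simp add: first_ff_def pd_inner[OF diff_pd_X[OF assms] diff_pd_X[OF assms]])
  \<comment> \<open>The product rule yields six terms. Symmetry of second derivatives brings the
    indices into one order; four terms cancel in pairs and the other two are equal, giving the
    factor 2 that the division by 2 in \<open>christoffel\<close> removes.\<close>
  have "pd i (\<lambda>q. first_ff X q $ j $ l) p + pd j (\<lambda>q. first_ff X q $ i $ l) p
         - pd l (\<lambda>q. first_ff X q $ i $ j) p = 2 * (pd i (pd j X) p \<bullet> pd l X p)" for l
    unfolding g pd_pd_commute[OF assms, of j i] pd_pd_commute[OF assms, of l i]
      pd_pd_commute[OF assms, of l j]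
    by (simp add: inner_commute)
  then show ?thesis
    by (simp add: christoffel_def sum_distrib_left[symmetric] sum_divide_distrib)
qed

text \<open>By \<open>christoffel_eq\<close>, the Christoffel sum is the tangential projection of
  the second derivative of X. What remains is orthogonal to every coordinate vector and therefore a
  multiple of the normal.\<close>

lemma gauss_formula:
  assumes "p \<in> V"
  shows "pd i (pd j X) p - (\<Sum>k\<in>UNIV. christoffel X k i j p *\<^sub>R pd k X p)
       = (pd i (pd j X) p \<bullet> \<nu> p) *\<^sub>R \<nu> p"
proof -
  let ?G = "first_ff X p" and ?I = "matrix_inv (first_ff X p)"
  let ?b = "\<lambda>l. pd i (pd j X) p \<bullet> pd l X p"
  let ?T = "pd i (pd j X) p - (\<Sum>k\<in>UNIV. christoffel X k i j p *\<^sub>R pd k X p)"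
  have "pd m X p \<bullet> ?T = 0" for m
  proof -
    \<comment> \<open>Pairing with the m-th coordinate vector multiplies the inverse metric in
      \<open>christoffel\<close> by the metric, leaving only the term l = m.\<close>
    have "(\<Sum>k\<in>UNIV. christoffel X k i j p * (pd m X p \<bullet> pd k X p))
        = (\<Sum>k\<in>UNIV. \<Sum>l\<in>UNIV. ?G $ m $ k * ?I $ k $ l * ?b l)"
      by (simp add: christoffel_eq[OF assms] sum_distrib_left first_ff_def mult_ac)
    also have "\<dots> = (\<Sum>l\<in>UNIV. (?G ** ?I) $ m $ l * ?b l)"
      by (subst sum.swap) (simp add: matrix_matrix_mult_def sum_distrib_right)
    also have "\<dots> = ?b m"
      by (simp add: first_ff_inv[OF assms] mat_def if_distrib[of "\<lambda>x. x * _"] cong: if_cong)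
    finally show ?thesis
      by (simp add: inner_diff_right inner_sum_right inner_commute)
  qed
  then have "?T = (?T \<bullet> \<nu> p) *\<^sub>R \<nu> p"
    by (rule orthogonal_tangent_imp_normal[OF assms])
  moreover have "?T \<bullet> \<nu> p = pd i (pd j X) p \<bullet> \<nu> p"
    using normal_\<nu>[OF assms] by (simp add: inner_diff_left inner_sum_left pd_def)
  ultimately show ?thesis by simp
qed

text \<open>Differentiate the identity that coordinate vectors are orthogonal to the normal, valid
  on all of V. The minus sign reflects the convention A(Y, Z) = <D_Y N, Z>.\<close>

lemma second_ff_eq:
  assumes "p \<in> V"
  shows "second_ff X \<nu> p $ j $ i = - (pd i (pd j X) p \<bullet> \<nu> p)"
proof -
  have "pd j (\<lambda>q. pd i X q \<bullet> \<nu> q) p = pd j (\<lambda>q. 0) p"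
    using normal_\<nu> by (intro pd_cong[OF assms]) (simp add: pd_def)
  then have "pd j (pd i X) p \<bullet> \<nu> p + pd i X p \<bullet> pd j \<nu> p = 0"
    by (simp add: pd_inner[OF diff_pd_X[OF assms] diff_\<nu>[OF assms]]) (simp add: pd_def)
  then show ?thesis
    by (simp add: second_ff_def inner_commute pd_pd_commute[OF assms, of i j])
qed

section \<open>Laplacian of the height function\<close>

lemma pd_height: "p \<in> V \<Longrightarrow> pd j (\<lambda>q. X q \<bullet> v) p = pd j X p \<bullet> v"
  by (rule pd_inner_const[OF diff_X])

lemma pd_pd_height:
  assumes "p \<in> V"
  shows "pd i (pd j (\<lambda>q. X q \<bullet> v)) p = pd i (pd j X) p \<bullet> v"
  using pd_cong[OF assms, of "pd j (\<lambda>q. X q \<bullet> v)" "\<lambda>q. pd j X q \<bullet> v"] pd_height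
  by (simp add: pd_inner_const[OF diff_pd_X[OF assms]])

text \<open>This is the v-component of \<Delta> X = - H \<nu>, the trace of the Gauss formula. The
  transposed indices j, i of \<open>second_ff\<close> are those occurring in the trace of the matrix
  product that defines \<open>mean_curvature\<close>.\<close>

lemma laplacian_height:
  assumes "p \<in> V"
  shows "laplacian X (\<lambda>q. X q \<bullet> v) p = - mean_curvature X \<nu> p * (\<nu> p \<bullet> v)"
proof -
  have "pd i (pd j (\<lambda>q. X q \<bullet> v)) p
      - (\<Sum>k\<in>UNIV. christoffel X k i j p * pd k (\<lambda>q. X q \<bullet> v) p)
    = (pd i (pd j X) p - (\<Sum>k\<in>UNIV. christoffel X k i j p *\<^sub>R pd k X p)) \<bullet> v" for i j
    by (simp add: pd_pd_height[OF assms] pd_height[OF assms] inner_diff_left inner_sum_left)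
  then have "pd i (pd j (\<lambda>q. X q \<bullet> v)) p
      - (\<Sum>k\<in>UNIV. christoffel X k i j p * pd k (\<lambda>q. X q \<bullet> v) p)
    = - second_ff X \<nu> p $ j $ i * (\<nu> p \<bullet> v)" for i j
    by (simp add: gauss_formula[OF assms] second_ff_eq[OF assms])
  then show ?thesis
    by (simp add: laplacian_def mean_curvature_def trace_def matrix_matrix_mult_def
        sum_distrib_right sum_negf mult.assoc)
qed

section \<open>The exponential of the negative height\<close>

lemma pd_exp_height:
  assumes "p \<in> V"
  shows "pd j (\<lambda>q. exp (- (X q \<bullet> v))) p = - exp (- (X p \<bullet> v)) * (pd j X p \<bullet> v)"
proof -
  have "(X has_derivative frechet_derivative X (at p)) (at p)"
    using diff_X[OF assms] by (simp add: frechet_derivative_works)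
  from has_derivative_exp[OF has_derivative_minus[OF has_derivative_inner_left[OF this, of v]]]
  show ?thesis
    by (simp add: pd_def frechet_derivative_eqI mult.commute)
qed

lemma pd_pd_exp_height:
  assumes "p \<in> V"
  shows "pd i (pd j (\<lambda>q. exp (- (X q \<bullet> v)))) p
    = exp (- (X p \<bullet> v)) * ((pd i X p \<bullet> v) * (pd j X p \<bullet> v) - pd i (pd j X) p \<bullet> v)"
proof -
  let ?e = "\<lambda>q. exp (- (X q \<bullet> v))"
  have e: "?e differentiable (at p)"
    using smooth_on_exp_neg_inner[OF open_V smooth_X, of v] assms
    unfolding smooth_on_def by (metis ck_on.simps(2))
  have l: "(\<lambda>q. - (pd j X q \<bullet> v)) differentiable (at p)"
    using has_derivative_minus[OF has_derivative_inner_left]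
      diff_pd_X[OF assms, of j] unfolding differentiable_def by blast
  \<comment> \<open>The product of reals is written as an inner product so that
    \<open>pd_inner\<close> acts as the Leibniz rule.\<close>
  have "pd i (pd j ?e) p = pd i (\<lambda>q. ?e q \<bullet> - (pd j X q \<bullet> v)) p"
    by (rule pd_cong[OF assms]) (simp add: pd_exp_height)
  also have "\<dots> = pd i ?e p * - (pd j X p \<bullet> v) + ?e p * pd i (\<lambda>q. - (pd j X q \<bullet> v)) p"
    using pd_inner[OF e l, of i] by (simp only: inner_real_def)
  \<comment> \<open>The sign is absorbed into the constant vector - v.\<close>
  also have "pd i (\<lambda>q. - (pd j X q \<bullet> v)) p = - (pd i (pd j X) p \<bullet> v)"
    using pd_inner_const[OF diff_pd_X[OF assms], of i j "- v"] by simp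
  finally show ?thesis
    by (simp add: pd_exp_height[OF assms] algebra_simps)
qed

text \<open>With w the height and u = exp(- w), \<Delta> u = u (|\<nabla> w|^2 - \<Delta> w) and
  g(\<nabla> w, \<nabla> u) = - u |\<nabla> w|^2. The quadratic terms cancel because the weight is w
  itself, and they do so separately for each pair of indices i, j.\<close>

lemma weighted_laplacian_exp_height:
  assumes "p \<in> V"
  shows "laplacian X (\<lambda>q. exp (- (X q \<bullet> v))) p
      + grad_inner X (\<lambda>q. X q \<bullet> v) (\<lambda>q. exp (- (X q \<bullet> v))) p
    = - exp (- (X p \<bullet> v)) * laplacian X (\<lambda>q. X q \<bullet> v) p"
  unfolding laplacian_def grad_inner_def sum.distrib[symmetric] sum_distrib_left
  by (intro sum.cong refl)
    (simp add: pd_exp_height[OF assms] pd_pd_exp_height[OF assms] pd_height[OF assms]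
      pd_pd_height[OF assms] algebra_simps sum_negf sum_distrib_left)

text \<open>The two halves of the final contradiction: the vanishing Laplacian kills the normal
  component of v, and the vanishing first derivatives make v orthogonal to the tangent
  space.\<close>

lemma laplacian_height_const:
  assumes "p \<in> V" "\<And>q. q \<in> V \<Longrightarrow> X q \<bullet> v = c"
  shows "laplacian X (\<lambda>q. X q \<bullet> v) p = 0" and "pd i X p \<bullet> v = 0"
proof -
  have 1: "pd k (\<lambda>q. X q \<bullet> v) q = 0" if "q \<in> V" for k q
    using pd_cong[OF that assms(2)] by (simp add: pd_def)
  have 2: "pd i (pd j (\<lambda>q. X q \<bullet> v)) p = 0" for i j
    using pd_cong[OF assms(1), of "pd j (\<lambda>q. X q \<bullet> v)" "\<lambda>q. 0" i] 1 by (simp add: pd_def[of i "\<lambda>q. 0"])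
  show "laplacian X (\<lambda>q. X q \<bullet> v) p = 0"
    by (simp add: laplacian_def 1[OF assms(1)] 2)
  show "pd i X p \<bullet> v = 0"
    using 1[OF assms(1)] pd_height[OF assms(1)] by simp
qed

end

section \<open>Translating solitons are not weighted parabolic\<close>

text \<open>Transfers the global hypotheses to a single chart, where the soliton equation expresses
  H through the normal component of v.\<close>

lemma translating_soliton_patch:
  fixes F N :: "'m \<Rightarrow> 'a::euclidean_space" and \<A> :: "('m, 'n::finite) chart set"
  assumes "translating_soliton M \<A> F N v" "(V, x) \<in> \<A>"
  shows "hypersurface_patch V (F \<circ> x) (N \<circ> x)"
    and "p \<in> V \<Longrightarrow> mean_curvature (F \<circ> x) (N \<circ> x) p = - (N (x p) \<bullet> v)"
proof -
  have "is_chart M (V, x)"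
    using assms unfolding translating_soliton_def oriented_hypersurface_def
      connected_smooth_manifold_def smooth_atlas_def by blast
  then have "open V"
    by (simp add: is_chart_def)
  then show "hypersurface_patch V (F \<circ> x) (N \<circ> x)"
    using assms unfolding translating_soliton_def oriented_hypersurface_def immersion_def
      unit_normal_def smooth_map_def by unfold_locales (auto simp: comp_def)
  show "mean_curvature (F \<circ> x) (N \<circ> x) p = - (N (x p) \<bullet> v)" if "p \<in> V"
    using assms that unfolding translating_soliton_def by fastforce
qed

theorem not_weighted_parabolic_translating_soliton:
  fixes F N :: "'m \<Rightarrow> 'a::euclidean_space" and \<A> :: "('m, 'n::finite) chart set"
  assumes sol: "translating_soliton M \<A> F N v" and v: "norm v = 1"
  shows "\<not> weighted_parabolic M \<A> F (\<lambda>y. y \<bullet> v)"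
proof
  assume par: "weighted_parabolic M \<A> F (\<lambda>y. y \<bullet> v)"
  define u where "u q = exp (- (F q \<bullet> v))" for q
  have lap: "laplacian (F \<circ> x) (\<lambda>q. (F \<circ> x) q \<bullet> v) p = (N (x p) \<bullet> v)\<^sup>2"
    if "(V, x) \<in> \<A>" "p \<in> V" for V x p
    using hypersurface_patch.laplacian_height[OF translating_soliton_patch(1)[OF sol that(1)] that(2)]
      translating_soliton_patch(2)[OF sol that] by (simp add: power2_eq_square)
  have "smooth_on V (u \<circ> x)" if "(V, x) \<in> \<A>" for V x
    using smooth_on_exp_neg_inner[OF hypersurface_patch.open_V hypersurface_patch.smooth_X,
        OF translating_soliton_patch(1) translating_soliton_patch(1), OF sol that sol that, of v]
    by (simp add: comp_def u_def)
  then have "smooth_map \<A> u"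
    by (auto simp: smooth_map_def)
  moreover have "laplacian (F \<circ> x) (u \<circ> x) p
      + grad_inner (F \<circ> x) ((\<lambda>y. y \<bullet> v) \<circ> F \<circ> x) (u \<circ> x) p \<le> 0"
    if "(V, x) \<in> \<A>" "p \<in> V" for V x p
    using hypersurface_patch.weighted_laplacian_exp_height
        [OF translating_soliton_patch(1)[OF sol that(1)] that(2), of v] lap[OF that]
    by (simp add: comp_def u_def)
  then have "\<forall>(V, x)\<in>\<A>. \<forall>p\<in>V. laplacian (F \<circ> x) (u \<circ> x) p
      + grad_inner (F \<circ> x) ((\<lambda>y. y \<bullet> v) \<circ> F \<circ> x) (u \<circ> x) p \<le> 0"
    by blast
  moreover have "\<forall>q\<in>topspace M. u q \<ge> 0"
    by (simp add: u_def)
  ultimately have "\<exists>c. \<forall>q\<in>topspace M. u q = c"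
    using par[unfolded weighted_parabolic_def, THEN spec, of u] by iprover
  then obtain c where c: "\<And>q. q \<in> topspace M \<Longrightarrow> u q = c"
    by blast
  have atlas: "smooth_atlas M \<A>" "topspace M \<noteq> {}"
    using sol unfolding translating_soliton_def oriented_hypersurface_def
      connected_smooth_manifold_def by blast+
  then obtain V x p where Vx: "(V, x) \<in> \<A>" "p \<in> V"
    unfolding smooth_atlas_def by blast
  interpret hypersurface_patch V "F \<circ> x" "N \<circ> x"
    by (rule translating_soliton_patch(1)[OF sol Vx(1)])
  \<comment> \<open>On the chart exp(- w) = c, so w = - ln c. One nonempty chart suffices, since the
    contradiction is reached at the single point p.\<close>
  have const: "(F \<circ> x) q \<bullet> v = - ln c" if "q \<in> V" for q
  proof -
    have "x q \<in> topspace M"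
      using atlas(1) Vx(1) that unfolding smooth_atlas_def by blast
    from c[OF this] show ?thesis
      by (auto simp: u_def)
  qed
  have "N (x p) \<bullet> v = 0"
    using laplacian_height_const(1)[OF Vx(2) const] lap[OF Vx] by simp
  then have "(v \<bullet> (N \<circ> x) p) *\<^sub>R (N \<circ> x) p = 0"
    by (simp add: inner_commute)
  \<comment> \<open>Orthogonality of v to the tangent space makes v equal to its normal component,
    which has just been shown to vanish.\<close>
  then have "v = 0"
    using orthogonal_tangent_imp_normal[OF Vx(2) laplacian_height_const(2)[OF Vx(2) const]]
    by (rule trans[rotated])
  then show False
    using v by simp
qed

theorem theorem5p3:
  assumes "CARD('k) = CARD('n) + 1"
  shows "\<not> (\<exists>(M :: 'm topology) (\<A> :: ('m, 'n::finite) chart set)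
              (F :: 'm \<Rightarrow> real ^ 'k::finite) (N :: 'm \<Rightarrow> real ^ 'k) (v :: real ^ 'k).
            norm v = 1 \<and>
            translating_soliton M \<A> F N v \<and>
            complete_hypersurface M F \<and>
            weighted_parabolic M \<A> F (\<lambda>y. y \<bullet> v) \<and>
            stable_hypersurface M \<A> F (\<lambda>y. y \<bullet> v))"
  using not_weighted_parabolic_translating_soliton by blast

end
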